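(* Let $A$ be an Archimedean $f$-algebra, let $B$ be a relatively uniformly complete Archimedean semiprime $f$-algebra, and let $T:A\to B$ be an order bounded linear operator. Then $T$ is a lattice homomorphism if and only if $\overline{T}:\overline{A}\to B$ is a lattice homomorphism.
   Context: All spaces are real. A Riesz algebra is a Riesz space with an associative algebra multiplication such that products of positive elements are positive. It is an $f$-algebra if $a\wedge b=0$ implies $ac\wedge b=ca\wedge b=0$ for all $c\ge 0$. An $f$-algebra is semiprime if $0$ is its only nilpotent element. A Riesz space is relatively uniformly complete if every relatively uniformly Cauchy sequence converges relatively uniformly. For an Archimedean Riesz space $A$, the relatively uniform completion $\overline{A}$ is the closure of $A$, in its Dedekind completion, with respect to the relatively uniform topology (whose closed sets are those containing all limits of their relatively uniformly convergent sequences). For an order bounded linear operator $T:A\to B$ into a relatively uniformly complete Archimedean $B$, $\overline{T}:\overline{A}\to B$ denotes its unique order bounded (hence relatively uniformly continuous) linear extension; when $T$ is positive, $\overline{T}(x)=\sup\{T(a):a\in A,\ 0\le a\le x\}$ for $0\le x\in\overline{A}$. *)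

theory Defs
  imports
    "HOL-Analysis.Abstract_Topology"
    "HOL-Library.Lattice_Algebras"
    "HOL-Library.FuncSet"
begin

section \<open>Riesz spaces and f-algebras\<close>

class riesz_space = ordered_real_vector + lattice_ab_group_add_abs

class archimedean_riesz_space = riesz_space +
  assumes archimedean: "0 \<le> x \<Longrightarrow> (\<And>n::nat. real n *\<^sub>R x \<le> y) \<Longrightarrow> x = 0"

class dedekind_complete_riesz_space = riesz_space + conditionally_complete_lattice

class riesz_algebra = riesz_space + real_algebra +
  assumes mult_positive: "0 \<le> a \<Longrightarrow> 0 \<le> b \<Longrightarrow> 0 \<le> a * b"

class f_algebra = riesz_algebra +
  assumes f_algebra_right: "inf a b = 0 \<Longrightarrow> 0 \<le> c \<Longrightarrow> inf (a * c) b = 0"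
    and f_algebra_left: "inf a b = 0 \<Longrightarrow> 0 \<le> c \<Longrightarrow> inf (c * a) b = 0"

text \<open>There need not be a unit element, so powers are iterated products:
  \<open>((*) a ^^ n) a\<close> is the power of \<open>a\<close> with exponent \<open>n + 1\<close>.\<close>

definition (in mult_zero) nilpotent :: "'a \<Rightarrow> bool"
  where "nilpotent a \<longleftrightarrow> (\<exists>n. ((*) a ^^ n) a = 0)"

class semiprime_f_algebra = f_algebra +
  assumes semiprime: "nilpotent a \<Longrightarrow> a = 0"


section \<open>Relatively uniform convergence, topology and completeness\<close>

definition (in riesz_space) ru_convergent_to :: "(nat \<Rightarrow> 'a) \<Rightarrow> 'a \<Rightarrow> bool"
  where "ru_convergent_to X x \<longleftrightarrow>
    (\<exists>u\<ge>0. \<forall>\<epsilon>>0. \<exists>N. \<forall>n\<ge>N. \<bar>X n - x\<bar> \<le> \<epsilon> *\<^sub>R u)"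

definition (in riesz_space) ru_Cauchy :: "(nat \<Rightarrow> 'a) \<Rightarrow> bool"
  where "ru_Cauchy X \<longleftrightarrow>
    (\<exists>u\<ge>0. \<forall>\<epsilon>>0. \<exists>N. \<forall>m\<ge>N. \<forall>n\<ge>N. \<bar>X m - X n\<bar> \<le> \<epsilon> *\<^sub>R u)"

class ru_complete_riesz_space = riesz_space +
  assumes ru_complete: "ru_Cauchy X \<Longrightarrow> \<exists>x. ru_convergent_to X x"

definition ru_closed :: "'a::riesz_space set \<Rightarrow> bool"
  where "ru_closed F \<longleftrightarrow> (\<forall>X x. range X \<subseteq> F \<longrightarrow> ru_convergent_to X x \<longrightarrow> x \<in> F)"

definition ru_topology :: "'a::riesz_space topology"
  where "ru_topology = topology (\<lambda>U. ru_closed (- U))"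

lemma ru_convergent_to_subseq:
  assumes "ru_convergent_to X x" "strict_mono r"
  shows "ru_convergent_to (X \<circ> r) x"
proof -
  obtain u where "u \<ge> 0" and u: "\<And>\<epsilon>. \<epsilon> > 0 \<Longrightarrow> \<exists>N. \<forall>n\<ge>N. \<bar>X n - x\<bar> \<le> \<epsilon> *\<^sub>R u"
    using assms(1) unfolding ru_convergent_to_def by blast
  have "\<exists>N. \<forall>n\<ge>N. \<bar>(X \<circ> r) n - x\<bar> \<le> \<epsilon> *\<^sub>R u" if "\<epsilon> > 0" for \<epsilon>
  proof -
    obtain N where "\<forall>n\<ge>N. \<bar>X n - x\<bar> \<le> \<epsilon> *\<^sub>R u"
      using u[OF \<open>\<epsilon> > 0\<close>] by blast
    then show ?thesis
      using seq_suble[OF assms(2)] by (metis comp_apply order_trans)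
  qed
  with \<open>u \<ge> 0\<close> show ?thesis
    unfolding ru_convergent_to_def by blast
qed

lemma ru_closed_Un:
  assumes F: "ru_closed F" and G: "ru_closed G"
  shows "ru_closed (F \<union> G)"
  unfolding ru_closed_def
proof (intro allI impI)
  fix X x assume X: "range X \<subseteq> F \<union> G" and x: "ru_convergent_to X x"
  have *: "x \<in> H" if "infinite {n. X n \<in> H}" "ru_closed H" for H
  proof -
    obtain r :: "nat \<Rightarrow> nat" where "strict_mono r" and r: "\<And>n. r n \<in> {n. X n \<in> H}"
      using infinite_enumerate[OF \<open>infinite {n. X n \<in> H}\<close>] by auto
    have "ru_convergent_to (X \<circ> r) x"
      using x \<open>strict_mono r\<close> by (rule ru_convergent_to_subseq)
    moreover have "range (X \<circ> r) \<subseteq> H"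
      using r by auto
    ultimately show ?thesis
      using \<open>ru_closed H\<close> unfolding ru_closed_def by blast
  qed
  have "{n. X n \<in> F} \<union> {n. X n \<in> G} = UNIV"
    using X by auto
  then have "infinite {n. X n \<in> F} \<or> infinite {n. X n \<in> G}"
    by (metis finite_Un infinite_UNIV_nat)
  then show "x \<in> F \<union> G"
    using * F G by blast
qed

lemma ru_closed_Inter: "(\<And>F. F \<in> \<F> \<Longrightarrow> ru_closed F) \<Longrightarrow> ru_closed (\<Inter>\<F>)"
  unfolding ru_closed_def by blast

lemma istopology_ru: "istopology (\<lambda>U::'a::riesz_space set. ru_closed (- U))"
  unfolding istopology_def
proof (intro conjI allI impI)
  fix S T :: "'a set" assume "ru_closed (- S)" "ru_closed (- T)"
  then show "ru_closed (- (S \<inter> T))"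
    by (simp add: Compl_Int ru_closed_Un)
next
  fix \<K> :: "'a set set" assume "\<forall>K\<in>\<K>. ru_closed (- K)"
  then show "ru_closed (- \<Union>\<K>)"
    using ru_closed_Inter[of "uminus ` \<K>"] by (auto simp: uminus_Sup)
qed

lemma openin_ru_topology: "openin ru_topology U \<longleftrightarrow> ru_closed (- U)"
  by (simp add: ru_topology_def topology_inverse'[OF istopology_ru])

lemma topspace_ru_topology [simp]: "topspace ru_topology = UNIV"
proof -
  have "openin ru_topology (UNIV :: 'a set)"
    by (simp add: openin_ru_topology ru_closed_def)
  then show ?thesis
    using openin_subset by blast
qed

lemma closedin_ru_topology: "closedin ru_topology F \<longleftrightarrow> ru_closed F"
  by (simp add: closedin_def openin_ru_topology Compl_eq_Diff_UNIV[symmetric])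


section \<open>Operators\<close>

text \<open>The operators below are defined on a Riesz subspace \<open>L\<close> of the type \<open>'a\<close>;
  order boundedness refers to order intervals of \<open>L\<close>.\<close>

definition linear_on :: "'a::real_vector set \<Rightarrow> ('a \<Rightarrow> 'b::real_vector) \<Rightarrow> bool"
  where "linear_on L S \<longleftrightarrow>
    (\<forall>x\<in>L. \<forall>y\<in>L. S (x + y) = S x + S y) \<and> (\<forall>c. \<forall>x\<in>L. S (c *\<^sub>R x) = c *\<^sub>R S x)"

definition order_bounded_on :: "'a::riesz_space set \<Rightarrow> ('a \<Rightarrow> 'b::riesz_space) \<Rightarrow> bool"
  where "order_bounded_on L S \<longleftrightarrow>
    (\<forall>l\<in>L. \<forall>u\<in>L. bdd_below (S ` (L \<inter> {l..u})) \<and> bdd_above (S ` (L \<inter> {l..u})))"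

definition lattice_hom_on :: "'a::lattice set \<Rightarrow> ('a \<Rightarrow> 'b::lattice) \<Rightarrow> bool"
  where "lattice_hom_on L S \<longleftrightarrow>
    (\<forall>x\<in>L. \<forall>y\<in>L. S (sup x y) = sup (S x) (S y) \<and> S (inf x y) = inf (S x) (S y))"


section \<open>Dedekind completion and relatively uniform completion\<close>

text \<open>\<open>\<iota>\<close> embeds \<open>'a\<close> as a Riesz subspace of the Dedekind complete space \<open>'d\<close> in such a way
  that each element of \<open>'d\<close> is both the supremum of the elements of \<open>'a\<close> below it and the
  infimum of those above it. This determines \<open>'d\<close> and \<open>\<iota>\<close> up to a unique isomorphism.
  The nonemptiness conditions are needed because \<^term>\<open>Sup {}\<close> and \<^term>\<open>Inf {}\<close>
  are arbitrary in \<^class>\<open>conditionally_complete_lattice\<close>.\<close>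

definition dedekind_completion ::
    "('a::riesz_space \<Rightarrow> 'd::dedekind_complete_riesz_space) \<Rightarrow> bool"
  where "dedekind_completion \<iota> \<longleftrightarrow>
    linear \<iota> \<and> lattice_hom_on UNIV \<iota> \<and> inj \<iota> \<and>
    (\<forall>x. {a. \<iota> a \<le> x} \<noteq> {} \<and> Sup (\<iota> ` {a. \<iota> a \<le> x}) = x \<and>
         {a. x \<le> \<iota> a} \<noteq> {} \<and> Inf (\<iota> ` {a. x \<le> \<iota> a}) = x)"

definition ru_completion ::
    "('a::riesz_space \<Rightarrow> 'd::dedekind_complete_riesz_space) \<Rightarrow> 'd set"
  where "ru_completion \<iota> = ru_topology closure_of (range \<iota>)"

text \<open>Membership in \<^const>\<open>extensional\<close> fixes the irrelevant values outside the completion,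
  which makes the extension unique as a total function.\<close>

definition ru_extension ::
    "('a::riesz_space \<Rightarrow> 'd::dedekind_complete_riesz_space) \<Rightarrow>
     ('a \<Rightarrow> 'b::riesz_space) \<Rightarrow> 'd \<Rightarrow> 'b"
  where "ru_extension \<iota> T = (THE S.
    S \<in> extensional (ru_completion \<iota>) \<and>
    linear_on (ru_completion \<iota>) S \<and>
    order_bounded_on (ru_completion \<iota>) S \<and>
    (\<forall>a. S (\<iota> a) = T a))"

end

theory Submission
  imports Defs "HOL-Analysis.Product_Vector"
begin

text \<open>Write \<open>R\<close> for the relatively uniform completion of \<open>A\<close> inside its Dedekind completion \<open>D\<close>,
  and \<open>S\<close> for the extension of \<open>T\<close> to \<open>R\<close>. The theorem is a density argument.

  Everything rests on one estimate. If \<open>T\<close> maps the order interval \<open>[-u, u]\<close> into \<open>[-w, w]\<close>, then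
  by homogeneity it maps \<open>[-\<epsilon>u, \<epsilon>u]\<close> into \<open>[-\<epsilon>w, \<epsilon>w]\<close>, so an order bounded operator carries
  relatively uniform convergence with regulator \<open>u\<close> to relatively uniform convergence with
  regulator \<open>w\<close>. Since \<open>A\<close> majorizes \<open>D\<close>, every regulator in \<open>D\<close> can be replaced by one from \<open>A\<close>.

  Given a linear order bounded \<open>S\<close> on \<open>R\<close> extending \<open>T\<close>, the set of \<open>x \<in> R\<close> with
  \<open>S \<bar>x\<bar> = \<bar>S x\<bar>\<close> is therefore closed under relatively uniform limits. If \<open>T\<close> is a lattice
  homomorphism, this set contains \<open>A\<close> and hence is all of \<open>R\<close>; preserving absolute values, the
  linear map \<open>S\<close> preserves suprema and infima. Conversely, \<open>T\<close> is the restriction of \<open>S\<close> to a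
  sublattice. Two extensions agree on \<open>R\<close> by the same closure argument, applied to the set where
  they coincide.

  The main work is the existence of \<open>S\<close>. The set of limits of sequences in \<open>A\<close> need not
  be closed, because countably many regulators need not have a common majorant up to scaling, so a
  single passage to the limit is not enough. Instead, Zorn's lemma is applied to graphs of
  extensions that map each order interval \<open>[-u, u]\<close>, \<open>u \<in> A\<close>, into every \<open>[-w, w]\<close> that contains
  \<open>T [-u, u]\<close>. Such a bound survives the passage to limits (\<open>extension_graph_limit_graph\<close>), because a
  limit in \<open>[-u, u]\<close> can be approximated by truncated elements that stay in \<open>[-u, u]\<close>. A maximal
  graph has a domain that is closed and contains \<open>A\<close>, so it contains \<open>R\<close>
  (\<open>extension_exists\<close>).\<close>

section \<open>Relatively uniform limits\<close>

lemma abs_scaleR_le: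
  fixes x :: "'a::riesz_space"
  assumes "0 \<le> c"
  shows "\<bar>c *\<^sub>R x\<bar> \<le> c *\<^sub>R \<bar>x\<bar>"
proof (rule abs_leI)
  show "c *\<^sub>R x \<le> c *\<^sub>R \<bar>x\<bar>"
    using assms by (intro scaleR_left_mono abs_ge_self)
  have "c *\<^sub>R (- x) \<le> c *\<^sub>R \<bar>x\<bar>"
    using assms by (intro scaleR_left_mono abs_ge_minus_self)
  then show "- (c *\<^sub>R x) \<le> c *\<^sub>R \<bar>x\<bar>"
    by simp
qed

lemma abs_scaleR_inverse_le:
  fixes x :: "'a::riesz_space"
  assumes "0 < \<epsilon>" "\<bar>x\<bar> \<le> \<epsilon> *\<^sub>R v"
  shows "\<bar>inverse \<epsilon> *\<^sub>R x\<bar> \<le> v"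
proof -
  have "\<bar>inverse \<epsilon> *\<^sub>R x\<bar> \<le> inverse \<epsilon> *\<^sub>R \<bar>x\<bar>"
    using assms by (intro abs_scaleR_le) simp
  also have "\<dots> \<le> inverse \<epsilon> *\<^sub>R (\<epsilon> *\<^sub>R v)"
    using assms by (intro scaleR_left_mono) simp_all
  finally show ?thesis
    using assms by simp
qed

lemma abs_le_scaleR_of_inverse:
  fixes x :: "'a::riesz_space"
  assumes "0 < \<epsilon>" "\<bar>inverse \<epsilon> *\<^sub>R x\<bar> \<le> v"
  shows "\<bar>x\<bar> \<le> \<epsilon> *\<^sub>R v"
  using abs_scaleR_inverse_le[of "inverse \<epsilon>" "inverse \<epsilon> *\<^sub>R x" "\<epsilon> *\<^sub>R v"] assms by simp

lemma abs_sup_diff_le: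
  fixes a b c d :: "'a::riesz_space"
  shows "\<bar>sup a b - sup c d\<bar> \<le> \<bar>a - c\<bar> + \<bar>b - d\<bar>"
proof -
  have *: "sup a b \<le> sup c d + (\<bar>a - c\<bar> + \<bar>b - d\<bar>)" for a b c d :: 'a
  proof (rule sup_least)
    have "a - c \<le> \<bar>a - c\<bar> + \<bar>b - d\<bar>"
      using add_mono[OF abs_ge_self[of "a - c"] abs_ge_zero[of "b - d"]] by simp
    from add_mono[OF sup_ge1[of c d] this] show "a \<le> sup c d + (\<bar>a - c\<bar> + \<bar>b - d\<bar>)"
      by simp
    have "b - d \<le> \<bar>a - c\<bar> + \<bar>b - d\<bar>"
      using add_mono[OF abs_ge_zero[of "a - c"] abs_ge_self[of "b - d"]] by simp
    from add_mono[OF sup_ge2[of d c] this] show "b \<le> sup c d + (\<bar>a - c\<bar> + \<bar>b - d\<bar>)"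
      by simp
  qed
  have "sup a b - sup c d \<le> \<bar>a - c\<bar> + \<bar>b - d\<bar>"
    using *[of a b c d] by (simp only: diff_le_eq add.commute)
  moreover have "- (sup a b - sup c d) \<le> \<bar>a - c\<bar> + \<bar>b - d\<bar>"
    using *[of c d a b] by (simp only: minus_diff_eq diff_le_eq add.commute abs_minus_commute)
  ultimately show ?thesis
    by (rule abs_leI)
qed

text \<open>The sum of a regulator of \<open>X\<close> and one of \<open>Y\<close> is a regulator of \<open>Z\<close>. Addition, subtraction,
  suprema and absolute values satisfy the assumed Lipschitz estimate, which gives their
  continuity.\<close>
lemma ru_convergent_to_dominated:
  assumes X: "ru_convergent_to X (x::'a::riesz_space)"
    and Y: "ru_convergent_to Y (y::'a)"
    and dom: "\<And>n. \<bar>Z n - z\<bar> \<le> \<bar>X n - x\<bar> + \<bar>Y n - y\<bar>"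
  shows "ru_convergent_to Z z"
proof -
  obtain u where u: "u \<ge> 0" "\<And>\<epsilon>. \<epsilon> > 0 \<Longrightarrow> \<exists>N. \<forall>n\<ge>N. \<bar>X n - x\<bar> \<le> \<epsilon> *\<^sub>R u"
    using X unfolding ru_convergent_to_def by blast
  obtain v where v: "v \<ge> 0" "\<And>\<epsilon>. \<epsilon> > 0 \<Longrightarrow> \<exists>N. \<forall>n\<ge>N. \<bar>Y n - y\<bar> \<le> \<epsilon> *\<^sub>R v"
    using Y unfolding ru_convergent_to_def by blast
  have "\<exists>N. \<forall>n\<ge>N. \<bar>Z n - z\<bar> \<le> \<epsilon> *\<^sub>R (u + v)" if "\<epsilon> > 0" for \<epsilon>
  proof -
    obtain M where M: "\<forall>n\<ge>M. \<bar>X n - x\<bar> \<le> \<epsilon> *\<^sub>R u"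
      using u(2)[OF \<open>\<epsilon> > 0\<close>] by blast
    obtain N where N: "\<forall>n\<ge>N. \<bar>Y n - y\<bar> \<le> \<epsilon> *\<^sub>R v"
      using v(2)[OF \<open>\<epsilon> > 0\<close>] by blast
    have "\<bar>Z n - z\<bar> \<le> \<epsilon> *\<^sub>R (u + v)" if "n \<ge> max M N" for n
    proof -
      have "\<bar>X n - x\<bar> + \<bar>Y n - y\<bar> \<le> \<epsilon> *\<^sub>R u + \<epsilon> *\<^sub>R v"
        using M N that by (intro add_mono) auto
      then show ?thesis
        using dom[of n] by (auto simp: scaleR_add_right intro: order_trans)
    qed
    then show ?thesis by blast
  qed
  then show ?thesis
    using u(1) v(1) unfolding ru_convergent_to_def by (metis add_nonneg_nonneg)
qed

lemma ru_convergent_to_const: "ru_convergent_to (\<lambda>n. x::'a::riesz_space) x"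
  unfolding ru_convergent_to_def by (intro exI[of _ 0]) simp

lemma ru_convergent_to_add:
  assumes "ru_convergent_to X (x::'a::riesz_space)" "ru_convergent_to Y (y::'a)"
  shows "ru_convergent_to (\<lambda>n. X n + Y n) (x + y)"
  using assms by (rule ru_convergent_to_dominated) (metis add_diff_add abs_triangle_ineq)

lemma ru_convergent_to_diff:
  assumes "ru_convergent_to X (x::'a::riesz_space)" "ru_convergent_to Y (y::'a)"
  shows "ru_convergent_to (\<lambda>n. X n - Y n) (x - y)"
  using assms
proof (rule ru_convergent_to_dominated)
  show "\<bar>X n - Y n - (x - y)\<bar> \<le> \<bar>X n - x\<bar> + \<bar>Y n - y\<bar>" for n
    using abs_triangle_ineq4[of "X n - x" "Y n - y"] by (simp add: algebra_simps)
qed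

lemma ru_convergent_to_sup:
  assumes "ru_convergent_to X (x::'a::riesz_space)" "ru_convergent_to Y (y::'a)"
  shows "ru_convergent_to (\<lambda>n. sup (X n) (Y n)) (sup x y)"
  using assms by (rule ru_convergent_to_dominated) (rule abs_sup_diff_le)

lemma inf_eq_add_diff_sup: "inf x y = x + y - sup x (y::'a::riesz_space)"
  by (simp only: add_eq_inf_sup[of x y] add_diff_cancel_left' add_diff_cancel_right')

lemma sup_eq_half_abs: "sup x y = (1/2) *\<^sub>R (x + y + \<bar>x - y\<bar>)" for x y :: "'a::riesz_space"
proof -
  have "x + y + \<bar>x - y\<bar> = sup (x + y + (x - y)) (x + y + - (x - y))"
    unfolding abs_lattice by (rule add_sup_distrib_left)
  also have "\<dots> = sup (x + x) (y + y)"
    by (simp add: algebra_simps)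
  also have "\<dots> = sup x y + sup x y"
  proof (rule antisym)
    show "sup (x + x) (y + y) \<le> sup x y + sup x y"
      by (intro sup_least add_mono) simp_all
    have "(1/2) *\<^sub>R (x + x) \<le> (1/2) *\<^sub>R sup (x + x) (y + y)"
      "(1/2) *\<^sub>R (y + y) \<le> (1/2) *\<^sub>R sup (x + x) (y + y)"
      by (intro scaleR_left_mono; simp)+
    then have "sup x y \<le> (1/2) *\<^sub>R sup (x + x) (y + y)"
      by (simp flip: scaleR_2)
    then have "sup x y + sup x y \<le> (1/2) *\<^sub>R sup (x + x) (y + y) + (1/2) *\<^sub>R sup (x + x) (y + y)"
      by (intro add_mono)
    then show "sup x y + sup x y \<le> sup (x + x) (y + y)"
      by (simp flip: scaleR_add_left)
  qed
  finally show ?thesis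
    by (simp flip: scaleR_2)
qed

lemma ru_convergent_to_inf:
  assumes "ru_convergent_to X (x::'a::riesz_space)" "ru_convergent_to Y (y::'a)"
  shows "ru_convergent_to (\<lambda>n. inf (X n) (Y n)) (inf x y)"
  unfolding inf_eq_add_diff_sup
  using assms by (intro ru_convergent_to_diff ru_convergent_to_add ru_convergent_to_sup)

lemma ru_convergent_to_abs:
  assumes "ru_convergent_to X (x::'a::riesz_space)"
  shows "ru_convergent_to (\<lambda>n. \<bar>X n\<bar>) \<bar>x\<bar>"
  using assms ru_convergent_to_const[of 0]
  by (rule ru_convergent_to_dominated) (simp add: abs_triangle_ineq3)

lemma ru_convergent_to_scaleR:
  assumes "ru_convergent_to X (x::'a::riesz_space)"
  shows "ru_convergent_to (\<lambda>n. c *\<^sub>R X n) (c *\<^sub>R x)"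
proof -
  obtain u where u: "u \<ge> 0" "\<And>\<epsilon>. \<epsilon> > 0 \<Longrightarrow> \<exists>N. \<forall>n\<ge>N. \<bar>X n - x\<bar> \<le> \<epsilon> *\<^sub>R u"
    using assms unfolding ru_convergent_to_def by blast
  have le: "\<bar>c *\<^sub>R z\<bar> \<le> \<bar>c\<bar> *\<^sub>R \<bar>z\<bar>" for z :: 'a
    using abs_scaleR_le[of "\<bar>c\<bar>" z] by (cases "c \<ge> 0") simp_all
  have "\<bar>c *\<^sub>R X n - c *\<^sub>R x\<bar> \<le> \<epsilon> *\<^sub>R (\<bar>c\<bar> *\<^sub>R u)" if "\<bar>X n - x\<bar> \<le> \<epsilon> *\<^sub>R u" for n \<epsilon>
  proof -
    have "\<bar>c *\<^sub>R (X n - x)\<bar> \<le> \<bar>c\<bar> *\<^sub>R (\<epsilon> *\<^sub>R u)"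
      using le that by (rule order_trans[OF _ scaleR_left_mono]) simp
    then show ?thesis by (simp add: scaleR_diff_right mult.commute)
  qed
  moreover have "0 \<le> \<bar>c\<bar> *\<^sub>R u"
    using u(1) by (simp add: scaleR_nonneg_nonneg)
  ultimately show ?thesis
    using u(2) unfolding ru_convergent_to_def by meson
qed

lemma ru_convergent_to_imp_ru_Cauchy:
  assumes "ru_convergent_to X (x::'a::riesz_space)"
  shows "ru_Cauchy X"
proof -
  obtain u where u: "u \<ge> 0" "\<And>\<epsilon>. \<epsilon> > 0 \<Longrightarrow> \<exists>N. \<forall>n\<ge>N. \<bar>X n - x\<bar> \<le> \<epsilon> *\<^sub>R u"
    using assms unfolding ru_convergent_to_def by blast
  have "\<exists>N. \<forall>m\<ge>N. \<forall>n\<ge>N. \<bar>X m - X n\<bar> \<le> \<epsilon> *\<^sub>R u" if "\<epsilon> > 0" for \<epsilon>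
  proof -
    obtain N where N: "\<forall>n\<ge>N. \<bar>X n - x\<bar> \<le> (\<epsilon> / 2) *\<^sub>R u"
      using u(2)[of "\<epsilon> / 2"] \<open>\<epsilon> > 0\<close> by auto
    have "\<bar>X m - X n\<bar> \<le> \<epsilon> *\<^sub>R u" if "m \<ge> N" "n \<ge> N" for m n
    proof -
      have "\<bar>X m - X n\<bar> \<le> \<bar>X m - x\<bar> + \<bar>X n - x\<bar>"
        using abs_triangle_ineq4[of "X m - x" "X n - x"] by simp
      also have "\<dots> \<le> (\<epsilon> / 2) *\<^sub>R u + (\<epsilon> / 2) *\<^sub>R u"
        using N that by (intro add_mono) auto
      also have "\<dots> = \<epsilon> *\<^sub>R u"
        by (simp flip: scaleR_add_left)
      finally show ?thesis .
    qed
    then show ?thesis by blast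
  qed
  then show ?thesis
    using u(1) unfolding ru_Cauchy_def by blast
qed

text \<open>The positive part of \<open>y - w\<close> is at most \<open>\<epsilon>u\<close> for all \<open>\<epsilon> > 0\<close>, where \<open>u\<close> is a regulator, and
  the Archimedean property makes it vanish. In particular limits are unique.\<close>
lemma ru_limit_le:
  fixes y :: "'b::archimedean_riesz_space"
  assumes "ru_convergent_to Y y" "\<And>n. Y n \<le> w"
  shows "y \<le> w"
proof -
  obtain u where u: "u \<ge> 0" "\<And>\<epsilon>. \<epsilon> > 0 \<Longrightarrow> \<exists>N. \<forall>n\<ge>N. \<bar>Y n - y\<bar> \<le> \<epsilon> *\<^sub>R u"
    using assms(1) unfolding ru_convergent_to_def by blast
  have "real n *\<^sub>R sup (y - w) 0 \<le> u" for n
  proof (cases "n = 0")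
    case False
    obtain m where "\<bar>Y m - y\<bar> \<le> inverse (real n) *\<^sub>R u"
      using u(2)[of "inverse (real n)"] False by auto
    moreover have "y - w \<le> \<bar>Y m - y\<bar>"
    proof -
      have "y - w \<le> y - Y m"
        using assms(2)[of m] by (rule diff_left_mono)
      also have "\<dots> \<le> \<bar>Y m - y\<bar>"
        using abs_ge_self[of "y - Y m"] by (simp add: abs_minus_commute)
      finally show ?thesis .
    qed
    ultimately have "sup (y - w) 0 \<le> inverse (real n) *\<^sub>R u"
      using u(1) by (auto intro: order_trans scaleR_nonneg_nonneg)
    then have "real n *\<^sub>R sup (y - w) 0 \<le> real n *\<^sub>R (inverse (real n) *\<^sub>R u)"
      by (rule scaleR_left_mono) simp
    then show ?thesis
      using False by simp
  qed (use u(1) in simp)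
  then have "sup (y - w) 0 = 0"
    by (intro archimedean[of _ u]) simp_all
  then show ?thesis
    by (metis diff_le_0_iff_le sup_ge1)
qed

lemma ru_limit_unique:
  fixes y :: "'b::archimedean_riesz_space"
  assumes "ru_convergent_to Y y" "ru_convergent_to Y z"
  shows "y = z"
proof -
  have lim: "ru_convergent_to (\<lambda>n. 0) (y - z)" "ru_convergent_to (\<lambda>n. 0) (z - y)"
    using ru_convergent_to_diff[OF assms] ru_convergent_to_diff[OF assms(2,1)] by simp_all
  have "y - z \<le> 0" "z - y \<le> 0"
    using ru_limit_le[OF lim(1), of 0] ru_limit_le[OF lim(2), of 0] by simp_all
  then show ?thesis by simp
qed

lemma abs_le_interval_iff: "\<bar>x\<bar> \<le> v \<longleftrightarrow> - v \<le> x \<and> x \<le> v" for x :: "'a::riesz_space"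
proof
  assume "\<bar>x\<bar> \<le> v"
  then show "- v \<le> x \<and> x \<le> v"
    using abs_le_D1 abs_le_D2 minus_le_iff by blast
next
  assume "- v \<le> x \<and> x \<le> v"
  then show "\<bar>x\<bar> \<le> v"
    using abs_leI minus_le_iff by blast
qed

lemma order_bounded_on_interval:
  fixes S :: "'a::riesz_space \<Rightarrow> 'b::riesz_space"
  assumes "order_bounded_on M S" "- v \<in> M" "v \<in> M"
  shows "\<exists>w\<ge>0. \<forall>z\<in>M. \<bar>z\<bar> \<le> v \<longrightarrow> \<bar>S z\<bar> \<le> w"
proof -
  have bdd: "bdd_below (S ` (M \<inter> {- v..v}))" "bdd_above (S ` (M \<inter> {- v..v}))"
    using bspec[OF bspec[OF assms(1)[unfolded order_bounded_on_def] assms(2)] assms(3)] by simp_all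
  obtain l where l: "\<And>p. p \<in> S ` (M \<inter> {- v..v}) \<Longrightarrow> l \<le> p"
    using bdd(1) unfolding bdd_below_def by blast
  obtain h where h: "\<And>p. p \<in> S ` (M \<inter> {- v..v}) \<Longrightarrow> p \<le> h"
    using bdd(2) unfolding bdd_above_def by blast
  have "\<bar>S z\<bar> \<le> \<bar>sup h (- l)\<bar>" if "z \<in> M" "\<bar>z\<bar> \<le> v" for z
  proof -
    have "S z \<in> S ` (M \<inter> {- v..v})"
      using that by (simp only: abs_le_interval_iff) simp
    then have "S z \<le> sup h (- l)" "- S z \<le> sup h (- l)"
      using l h by (simp_all add: le_supI1 le_supI2)
    then have "\<bar>S z\<bar> \<le> sup h (- l)"
      by (rule abs_leI)
    also have "\<dots> \<le> \<bar>sup h (- l)\<bar>"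
      by (rule abs_ge_self)
    finally show ?thesis .
  qed
  then show ?thesis
    using abs_ge_zero by blast
qed

lemma linear_on_diff:
  assumes "linear_on M S" "subspace M" "x \<in> M" "y \<in> M"
  shows "S (x - y) = S x - S y"
proof -
  have "S ((x - y) + y) = S (x - y) + S y"
    using assms subspace_diff[OF assms(2-4)] unfolding linear_on_def by blast
  then show ?thesis by simp
qed

text \<open>A regulator \<open>v \<in> M\<close> of \<open>X\<close> yields as regulator of the image sequence any \<open>w\<close> such that
  \<open>S\<close> maps \<open>M \<inter> [-v, v]\<close> into \<open>[-w, w]\<close>. Majorization provides a regulator inside \<open>M\<close>,
  which is needed since order boundedness on \<open>M\<close> only speaks of intervals with end points in
  \<open>M\<close>.\<close>
lemma order_bounded_on_ru_continuous:
  fixes S :: "'a::riesz_space \<Rightarrow> 'b::riesz_space"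
  assumes M: "subspace M" "\<And>v. \<exists>u\<in>M. v \<le> u"
    and S: "linear_on M S" "order_bounded_on M S"
    and X: "\<And>n. X n \<in> M" "x \<in> M" "ru_convergent_to X x"
  shows "ru_convergent_to (\<lambda>n. S (X n)) (S x)"
proof -
  obtain u where u: "\<And>\<epsilon>. \<epsilon> > 0 \<Longrightarrow> \<exists>N. \<forall>n\<ge>N. \<bar>X n - x\<bar> \<le> \<epsilon> *\<^sub>R u"
    using X(3) unfolding ru_convergent_to_def by blast
  obtain v where v: "v \<in> M" "u \<le> v"
    using M(2) by blast
  have "- v \<in> M"
    using M(1) v(1) by (rule subspace_neg)
  then obtain w where w0: "w \<ge> 0" and w: "\<And>z. z \<in> M \<Longrightarrow> \<bar>z\<bar> \<le> v \<Longrightarrow> \<bar>S z\<bar> \<le> w"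
    using order_bounded_on_interval[OF S(2) _ v(1)] by blast
  have bound: "\<bar>S z\<bar> \<le> \<epsilon> *\<^sub>R w" if "z \<in> M" "\<epsilon> > 0" "\<bar>z\<bar> \<le> \<epsilon> *\<^sub>R v" for z \<epsilon>
  proof -
    have "\<bar>inverse \<epsilon> *\<^sub>R z\<bar> \<le> v"
      using that(2,3) by (rule abs_scaleR_inverse_le)
    moreover have "inverse \<epsilon> *\<^sub>R z \<in> M"
      using M(1) that(1) by (rule subspace_scale)
    ultimately have "\<bar>S (inverse \<epsilon> *\<^sub>R z)\<bar> \<le> w"
      by (intro w)
    then have "\<bar>inverse \<epsilon> *\<^sub>R S z\<bar> \<le> w"
      using S(1) that(1) unfolding linear_on_def by simp
    then show ?thesis
      by (rule abs_le_scaleR_of_inverse[OF that(2)])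
  qed
  have "\<exists>N. \<forall>n\<ge>N. \<bar>S (X n) - S x\<bar> \<le> \<epsilon> *\<^sub>R w" if "\<epsilon> > 0" for \<epsilon>
  proof -
    obtain N where N: "\<forall>n\<ge>N. \<bar>X n - x\<bar> \<le> \<epsilon> *\<^sub>R u"
      using u[OF \<open>\<epsilon> > 0\<close>] by blast
    have "\<bar>S (X n) - S x\<bar> \<le> \<epsilon> *\<^sub>R w" if "n \<ge> N" for n
    proof -
      have "\<bar>X n - x\<bar> \<le> \<epsilon> *\<^sub>R v"
        using N that v(2) \<open>\<epsilon> > 0\<close> by (meson scaleR_left_mono less_imp_le order_trans)
      then show ?thesis
        using bound[OF subspace_diff[OF M(1) X(1) X(2)] \<open>\<epsilon> > 0\<close>] linear_on_diff[OF S(1) M(1) X(1,2)]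
        by simp
    qed
    then show ?thesis by blast
  qed
  then show ?thesis
    using w0 unfolding ru_convergent_to_def by blast
qed

section \<open>The relatively uniform completion as a Riesz subspace\<close>

lemma ru_closed_ru_completion: "ru_closed (ru_completion \<iota>)"
  unfolding ru_completion_def closedin_ru_topology[symmetric] by simp

lemma range_subset_ru_completion: "range \<iota> \<subseteq> ru_completion \<iota>"
  unfolding ru_completion_def by (rule closure_of_subset) simp

lemma ru_completion_minimal:
  assumes "ru_closed F" "range \<iota> \<subseteq> F"
  shows "ru_completion \<iota> \<subseteq> F"
  unfolding ru_completion_def
  using assms by (intro closure_of_minimal) (simp_all add: closedin_ru_topology)

text \<open>Preimages of closed sets under continuous maps are closed. This replaces an induction over
  the stages by which a closure is built from iterated limits of sequences.\<close>
lemma ru_completion_invariant: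
  assumes cont: "\<And>X x. ru_convergent_to X x \<Longrightarrow> ru_convergent_to (\<lambda>n. f (X n)) (f x)"
    and base: "\<And>a. f (\<iota> a) \<in> ru_completion \<iota>"
    and "x \<in> ru_completion \<iota>"
  shows "f x \<in> ru_completion \<iota>"
proof -
  have "ru_closed {x. f x \<in> ru_completion \<iota>}"
    unfolding ru_closed_def
  proof (intro allI impI)
    fix X x
    assume X: "range X \<subseteq> {x. f x \<in> ru_completion \<iota>}" "ru_convergent_to X x"
    then have "range (\<lambda>n. f (X n)) \<subseteq> ru_completion \<iota>"
      by auto
    then show "x \<in> {x. f x \<in> ru_completion \<iota>}"
      using ru_closed_ru_completion[of \<iota>] cont[OF X(2)] unfolding ru_closed_def by blast
  qed
  then have "ru_completion \<iota> \<subseteq> {x. f x \<in> ru_completion \<iota>}"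
    by (rule ru_completion_minimal) (use base in auto)
  then show ?thesis
    using assms(3) by blast
qed

text \<open>Majorization allows regulators to be chosen in the embedded space, where order bounded
  operators are controlled.\<close>
locale majorizing_riesz_embedding =
  fixes \<iota> :: "'a::riesz_space \<Rightarrow> 'd::dedekind_complete_riesz_space"
  assumes linear: "linear \<iota>"
    and lattice_hom: "lattice_hom_on UNIV \<iota>"
    and inj: "inj \<iota>"
    and majorizing: "\<exists>a. x \<le> \<iota> a"
begin

lemma sup: "\<iota> (sup a b) = sup (\<iota> a) (\<iota> b)"
  and inf: "\<iota> (inf a b) = inf (\<iota> a) (\<iota> b)"
  using lattice_hom unfolding lattice_hom_on_def by simp_all

lemma abs: "\<iota> \<bar>a\<bar> = \<bar>\<iota> a\<bar>"
  by (simp add: abs_lattice sup linear_neg[OF linear])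

lemma le_iff: "\<iota> a \<le> \<iota> b \<longleftrightarrow> a \<le> b"
  using inf[of a b] inj by (metis injD le_iff_inf)

lemma in_completion: "\<iota> a \<in> ru_completion \<iota>"
  using range_subset_ru_completion by blast

lemma subspace_completion: "subspace (ru_completion \<iota>)"
proof (rule subspaceI)
  show "0 \<in> ru_completion \<iota>"
    using in_completion[of 0] linear_0[OF linear] by simp
next
  fix x y assume x: "x \<in> ru_completion \<iota>" and y: "y \<in> ru_completion \<iota>"
  \<comment> \<open>One summand at a time: translations by elements of the original space preserve the completion,
    hence so do translations by its limits.\<close>
  have "x + \<iota> a \<in> ru_completion \<iota>" for a
  proof (rule ru_completion_invariant[where f = "\<lambda>z. z + \<iota> a", OF _ _ x])
    show "\<iota> b + \<iota> a \<in> ru_completion \<iota>" for b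
      using in_completion[of "b + a"] by (simp add: linear_add[OF linear])
  qed (intro ru_convergent_to_add ru_convergent_to_const)
  then show "x + y \<in> ru_completion \<iota>"
    by (intro ru_completion_invariant[where f = "\<lambda>z. x + z", OF _ _ y]
        ru_convergent_to_add ru_convergent_to_const)
next
  fix c x assume x: "x \<in> ru_completion \<iota>"
  show "c *\<^sub>R x \<in> ru_completion \<iota>"
  proof (rule ru_completion_invariant[OF _ _ x])
    show "c *\<^sub>R \<iota> a \<in> ru_completion \<iota>" for a
      using in_completion[of "c *\<^sub>R a"] by (simp add: linear_scale[OF linear])
  qed (rule ru_convergent_to_scaleR)
qed

lemma abs_in_completion:
  assumes "x \<in> ru_completion \<iota>"
  shows "\<bar>x\<bar> \<in> ru_completion \<iota>"
proof (rule ru_completion_invariant[OF _ _ assms])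
  show "\<bar>\<iota> a\<bar> \<in> ru_completion \<iota>" for a
    using in_completion[of "\<bar>a\<bar>"] by (simp add: abs)
qed (rule ru_convergent_to_abs)

lemma completion_majorizing: "\<exists>u\<in>ru_completion \<iota>. v \<le> u"
  using majorizing in_completion by blast

end

lemma dedekind_completion_majorizing:
  assumes "dedekind_completion \<iota>"
  shows "majorizing_riesz_embedding \<iota>"
proof (rule majorizing_riesz_embedding.intro)
  show "linear \<iota>" "lattice_hom_on UNIV \<iota>" "inj \<iota>"
    using assms unfolding dedekind_completion_def by blast+
  show "\<exists>a. x \<le> \<iota> a" for x
    using assms unfolding dedekind_completion_def by blast
qed

section \<open>Existence of the extension\<close>

text \<open>The inclusion of \<open>T [-u, u]\<close> in \<open>[-w, w]\<close>. In a space \<open>B\<close> that is not Dedekind complete, the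
  image \<open>T [-u, u]\<close> need not have a supremum, so bounds on it cannot be replaced by a best one.\<close>
definition maps_interval :: "('a::riesz_space \<Rightarrow> 'b::riesz_space) \<Rightarrow> 'a \<Rightarrow> 'b \<Rightarrow> bool"
  where "maps_interval T u w \<longleftrightarrow> (\<forall>a. \<bar>a\<bar> \<le> u \<longrightarrow> \<bar>T a\<bar> \<le> w)"

locale order_bounded_operator = majorizing_riesz_embedding \<iota>
  for \<iota> :: "'a::riesz_space \<Rightarrow> 'd::dedekind_complete_riesz_space" +
  fixes T :: "'a \<Rightarrow> 'b::{archimedean_riesz_space, ru_complete_riesz_space}"
  assumes linear_T: "linear T"
    and bounded_T: "order_bounded_on UNIV T"
begin

text \<open>Graphs of partial extensions of \<open>T\<close> to Riesz subspaces. That an extension is a function is not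
  demanded separately: the last clause with \<open>u = 0\<close> and \<open>w = 0\<close> forces \<open>y = 0\<close> for \<open>(0, y)\<close> in the
  graph. The domain is a sublattice so that its elements can be truncated.\<close>
definition extension_graph :: "('d \<times> 'b) set \<Rightarrow> bool"
  where "extension_graph G \<longleftrightarrow>
    subspace G \<and> range (\<lambda>a. (\<iota> a, T a)) \<subseteq> G \<and>
    (\<forall>x\<in>Domain G. \<forall>y\<in>Domain G. sup x y \<in> Domain G) \<and>
    (\<forall>x y u w. (x, y) \<in> G \<longrightarrow> maps_interval T u w \<longrightarrow> \<bar>x\<bar> \<le> \<iota> u \<longrightarrow> \<bar>y\<bar> \<le> w)"

lemma extension_graphD:
  assumes "extension_graph G"
  shows "subspace G" "(\<iota> a, T a) \<in> G"
    "x \<in> Domain G \<Longrightarrow> y \<in> Domain G \<Longrightarrow> sup x y \<in> Domain G"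
    "(x, z) \<in> G \<Longrightarrow> maps_interval T u w \<Longrightarrow> \<bar>x\<bar> \<le> \<iota> u \<Longrightarrow> \<bar>z\<bar> \<le> w"
  using assms unfolding extension_graph_def by blast+

lemma maps_some_interval: "\<exists>w\<ge>0. maps_interval T u w"
proof -
  obtain w where "w \<ge> 0" "\<forall>a\<in>UNIV. \<bar>a\<bar> \<le> u \<longrightarrow> \<bar>T a\<bar> \<le> w"
    using order_bounded_on_interval[OF bounded_T, of u] by blast
  then show ?thesis
    unfolding maps_interval_def by blast
qed

text \<open>The modulus of continuity \<open>w\<close> is determined by \<open>T\<close> and the regulator \<open>v\<close> alone, so it passes from
  regulators in the domain to regulators in the range.\<close>
lemma extension_graph_modulus:
  "\<exists>w\<ge>0. \<forall>G x y \<epsilon>. extension_graph G \<longrightarrow> (x, y) \<in> G \<longrightarrow> \<epsilon> > 0 \<longrightarrow> \<bar>x\<bar> \<le> \<epsilon> *\<^sub>R v \<longrightarrow> \<bar>y\<bar> \<le> \<epsilon> *\<^sub>R w"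
proof -
  obtain u where u: "v \<le> \<iota> u"
    using majorizing by blast
  obtain w where w: "w \<ge> 0" "maps_interval T u w"
    using maps_some_interval by blast
  have "\<bar>y\<bar> \<le> \<epsilon> *\<^sub>R w"
    if "extension_graph G" "(x, y) \<in> G" "\<epsilon> > 0" "\<bar>x\<bar> \<le> \<epsilon> *\<^sub>R v" for G x y \<epsilon>
  proof -
    have "inverse \<epsilon> *\<^sub>R (x, y) \<in> G"
      using extension_graphD(1)[OF that(1)] that(2) by (rule subspace_scale)
    then have "(inverse \<epsilon> *\<^sub>R x, inverse \<epsilon> *\<^sub>R y) \<in> G"
      by simp
    moreover have "\<bar>inverse \<epsilon> *\<^sub>R x\<bar> \<le> \<iota> u"
      using abs_scaleR_inverse_le[OF that(3,4)] u by (rule order_trans)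
    ultimately have "\<bar>inverse \<epsilon> *\<^sub>R y\<bar> \<le> w"
      using extension_graphD(4)[OF that(1)] w(2) by blast
    then show ?thesis
      by (rule abs_le_scaleR_of_inverse[OF that(3)])
  qed
  then show ?thesis
    using w(1) by blast
qed

lemma extension_graph_diff:
  assumes "extension_graph G" "(x, y) \<in> G" "(x', y') \<in> G"
  shows "(x - x', y - y') \<in> G"
  using subspace_diff[OF extension_graphD(1)[OF assms(1)] assms(2,3)] by simp

lemma extension_graph_inf:
  assumes G: "extension_graph G" and x: "x \<in> Domain G" and y: "y \<in> Domain G"
  shows "inf x y \<in> Domain G"
proof -
  obtain p q r where pqr: "(x, p) \<in> G" "(y, q) \<in> G" "(sup x y, r) \<in> G"
    using x y extension_graphD(3)[OF G x y] by blast
  have "(x + y, p + q) \<in> G"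
    using subspace_add[OF extension_graphD(1)[OF G] pqr(1,2)] by simp
  then have "(inf x y, p + q - r) \<in> G"
    using extension_graph_diff[OF G _ pqr(3)] unfolding inf_eq_add_diff_sup by blast
  then show ?thesis by blast
qed

lemma extension_graph_values_converge:
  assumes G: "extension_graph G" and XY: "\<And>n. (X n, Y n) \<in> G" and X: "ru_convergent_to X x"
  shows "\<exists>y. ru_convergent_to Y y"
proof -
  obtain v where v: "\<And>\<epsilon>. \<epsilon> > 0 \<Longrightarrow> \<exists>N. \<forall>m\<ge>N. \<forall>n\<ge>N. \<bar>X m - X n\<bar> \<le> \<epsilon> *\<^sub>R v"
    using ru_convergent_to_imp_ru_Cauchy[OF X] unfolding ru_Cauchy_def by blast
  obtain w where w: "w \<ge> 0"
    "\<And>x y \<epsilon>. (x, y) \<in> G \<Longrightarrow> \<epsilon> > 0 \<Longrightarrow> \<bar>x\<bar> \<le> \<epsilon> *\<^sub>R v \<Longrightarrow> \<bar>y\<bar> \<le> \<epsilon> *\<^sub>R w"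
    using extension_graph_modulus[of v] G by blast
  have "\<exists>N. \<forall>m\<ge>N. \<forall>n\<ge>N. \<bar>Y m - Y n\<bar> \<le> \<epsilon> *\<^sub>R w" if "\<epsilon> > 0" for \<epsilon>
  proof -
    obtain N where "\<forall>m\<ge>N. \<forall>n\<ge>N. \<bar>X m - X n\<bar> \<le> \<epsilon> *\<^sub>R v"
      using v[OF \<open>\<epsilon> > 0\<close>] by blast
    then have "\<forall>m\<ge>N. \<forall>n\<ge>N. \<bar>Y m - Y n\<bar> \<le> \<epsilon> *\<^sub>R w"
      using w(2)[OF extension_graph_diff[OF G XY XY] \<open>\<epsilon> > 0\<close>] by simp
    then show ?thesis by blast
  qed
  then have "ru_Cauchy Y"
    using w(1) unfolding ru_Cauchy_def by blast
  then show ?thesis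
    by (rule ru_complete)
qed

lemma extension_graph_null:
  assumes G: "extension_graph G" and XY: "\<And>n. (X n, Y n) \<in> G" and X: "ru_convergent_to X 0"
  shows "ru_convergent_to Y 0"
proof -
  obtain v where v: "\<And>\<epsilon>. \<epsilon> > 0 \<Longrightarrow> \<exists>N. \<forall>n\<ge>N. \<bar>X n\<bar> \<le> \<epsilon> *\<^sub>R v"
    using X unfolding ru_convergent_to_def by auto
  obtain w where w: "w \<ge> 0"
    "\<And>x y \<epsilon>. (x, y) \<in> G \<Longrightarrow> \<epsilon> > 0 \<Longrightarrow> \<bar>x\<bar> \<le> \<epsilon> *\<^sub>R v \<Longrightarrow> \<bar>y\<bar> \<le> \<epsilon> *\<^sub>R w"
    using extension_graph_modulus[of v] G by blast
  have "\<exists>N. \<forall>n\<ge>N. \<bar>Y n - 0\<bar> \<le> \<epsilon> *\<^sub>R w" if "\<epsilon> > 0" for \<epsilon>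
  proof -
    obtain N where "\<forall>n\<ge>N. \<bar>X n\<bar> \<le> \<epsilon> *\<^sub>R v"
      using v[OF \<open>\<epsilon> > 0\<close>] by blast
    then have "\<forall>n\<ge>N. \<bar>Y n - 0\<bar> \<le> \<epsilon> *\<^sub>R w"
      using w(2)[OF XY \<open>\<epsilon> > 0\<close>] by simp
    then show ?thesis by blast
  qed
  then show ?thesis
    using w(1) unfolding ru_convergent_to_def by blast
qed

definition limit_graph :: "('d \<times> 'b) set \<Rightarrow> ('d \<times> 'b) set"
  where "limit_graph G = {(x, y). \<exists>X Y. (\<forall>n. (X n, Y n) \<in> G) \<and>
    ru_convergent_to X x \<and> ru_convergent_to Y y}"

lemma limit_graphI:
  "(\<And>n. (X n, Y n) \<in> G) \<Longrightarrow> ru_convergent_to X x \<Longrightarrow> ru_convergent_to Y y \<Longrightarrow> (x, y) \<in> limit_graph G"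
  unfolding limit_graph_def by blast

lemma limit_graphD:
  assumes "(x, y) \<in> limit_graph G"
  shows "\<exists>X Y. (\<forall>n. (X n, Y n) \<in> G) \<and> ru_convergent_to X x \<and> ru_convergent_to Y y"
  using assms unfolding limit_graph_def by blast

lemma limit_graph_superset: "G \<subseteq> limit_graph G"
  by (auto intro: limit_graphI ru_convergent_to_const)

text \<open>Linearity of the limits is immediate. Suprema stay in the domain because the values at a
  convergent sequence are Cauchy and \<open>B\<close> is complete. For the interval bound, let \<open>(x, y)\<close> be the
  limit of \<open>(X n, Y n)\<close> with \<open>x \<in> [-u, u]\<close>. The truncations of \<open>X n\<close> to \<open>[-u, u]\<close> still converge to
  \<open>x\<close>, so their values differ from \<open>Y n\<close> by a null sequence and thus converge to \<open>y\<close>; they lie in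
  \<open>[-w, w]\<close>, and so does \<open>y\<close>.\<close>
lemma extension_graph_limit_graph:
  assumes G: "extension_graph G"
  shows "extension_graph (limit_graph G)"
  unfolding extension_graph_def
proof (intro conjI allI impI ballI)
  note sub = extension_graphD(1)[OF G]
  show "subspace (limit_graph G)"
  proof (rule subspaceI)
    show "0 \<in> limit_graph G"
      using limit_graph_superset subspace_0[OF sub] by blast
  next
    fix p q assume p: "p \<in> limit_graph G" and q: "q \<in> limit_graph G"
    obtain x y x' y' where [simp]: "p = (x, y)" "q = (x', y')"
      by (cases p, cases q)
    obtain X Y where XY: "\<And>n. (X n, Y n) \<in> G" "ru_convergent_to X x" "ru_convergent_to Y y"
      using limit_graphD p unfolding \<open>p = (x, y)\<close> by blast
    obtain X' Y' where XY': "\<And>n. (X' n, Y' n) \<in> G" "ru_convergent_to X' x'" "ru_convergent_to Y' y'"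
      using limit_graphD q unfolding \<open>q = (x', y')\<close> by blast
    have "(X n + X' n, Y n + Y' n) \<in> G" for n
      using subspace_add[OF sub XY(1)[of n] XY'(1)[of n]] by simp
    then have "(x + x', y + y') \<in> limit_graph G"
      using ru_convergent_to_add[OF XY(2) XY'(2)] ru_convergent_to_add[OF XY(3) XY'(3)]
      by (rule limit_graphI)
    then show "p + q \<in> limit_graph G"
      by simp
  next
    fix c p assume p: "p \<in> limit_graph G"
    obtain x y where [simp]: "p = (x, y)"
      by (cases p)
    obtain X Y where XY: "\<And>n. (X n, Y n) \<in> G" "ru_convergent_to X x" "ru_convergent_to Y y"
      using limit_graphD p unfolding \<open>p = (x, y)\<close> by blast
    have "(c *\<^sub>R X n, c *\<^sub>R Y n) \<in> G" for n
      using subspace_scale[OF sub XY(1)[of n]] by simp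
    then have "(c *\<^sub>R x, c *\<^sub>R y) \<in> limit_graph G"
      using ru_convergent_to_scaleR[OF XY(2)] ru_convergent_to_scaleR[OF XY(3)]
      by (rule limit_graphI)
    then show "c *\<^sub>R p \<in> limit_graph G"
      by simp
  qed
next
  show "range (\<lambda>a. (\<iota> a, T a)) \<subseteq> limit_graph G"
    using limit_graph_superset extension_graphD(2)[OF G] by blast
next
  fix x x' assume "x \<in> Domain (limit_graph G)" "x' \<in> Domain (limit_graph G)"
  then obtain y y' where "(x, y) \<in> limit_graph G" and xy': "(x', y') \<in> limit_graph G"
    by blast
  then obtain X Y where XY: "\<And>n. (X n, Y n) \<in> G" "ru_convergent_to X x"
    using limit_graphD by blast
  obtain X' Y' where XY': "\<And>n. (X' n, Y' n) \<in> G" "ru_convergent_to X' x'"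
    using limit_graphD[OF xy'] by blast
  have "\<exists>z. (sup (X n) (X' n), z) \<in> G" for n
    using extension_graphD(3)[OF G] XY(1)[of n] XY'(1)[of n] by blast
  then obtain Z where Z: "\<And>n. (sup (X n) (X' n), Z n) \<in> G"
    by metis
  have lim: "ru_convergent_to (\<lambda>n. sup (X n) (X' n)) (sup x x')"
    using XY(2) XY'(2) by (rule ru_convergent_to_sup)
  obtain z where "ru_convergent_to Z z"
    using extension_graph_values_converge[OF G Z lim] by blast
  then have "(sup x x', z) \<in> limit_graph G"
    using Z lim by (intro limit_graphI)
  then show "sup x x' \<in> Domain (limit_graph G)"
    by blast
next
  fix x y u w
  assume "(x, y) \<in> limit_graph G" and uw: "maps_interval T u w" and xu: "\<bar>x\<bar> \<le> \<iota> u"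
  then obtain X Y where XY: "\<And>n. (X n, Y n) \<in> G" "ru_convergent_to X x" "ru_convergent_to Y y"
    using limit_graphD by blast
  define t where "t z = sup (inf z (\<iota> u)) (- \<iota> u)" for z
  have u0: "0 \<le> \<iota> u"
    using xu abs_ge_zero order_trans by blast
  have t_bound: "\<bar>t z\<bar> \<le> \<iota> u" for z
    unfolding t_def abs_le_interval_iff using u0 by (simp add: le_supI2 order_trans[of _ 0])
  have "t x = x"
    using xu unfolding t_def abs_le_interval_iff by (simp add: inf.absorb1 sup.absorb1)
  have "ru_convergent_to (\<lambda>n. t (X n)) (t x)"
    unfolding t_def by (intro ru_convergent_to_sup ru_convergent_to_inf ru_convergent_to_const XY(2))
  then have tX: "ru_convergent_to (\<lambda>n. t (X n)) x"
    using \<open>t x = x\<close> by simp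
  have uG: "\<iota> u \<in> Domain G" "- \<iota> u \<in> Domain G"
    using extension_graphD(2)[OF G, of u] extension_graphD(2)[OF G, of "- u"]
    by (auto simp: linear_neg[OF linear])
  have "\<exists>z. (t (X n), z) \<in> G" for n
    using extension_graphD(3)[OF G extension_graph_inf[OF G DomainI[OF XY(1)[of n]] uG(1)] uG(2)]
    unfolding t_def by blast
  then obtain Z where Z: "\<And>n. (t (X n), Z n) \<in> G"
    by metis
  have "ru_convergent_to (\<lambda>n. X n - t (X n)) 0"
    using ru_convergent_to_diff[OF XY(2) tX] by simp
  then have "ru_convergent_to (\<lambda>n. Y n - Z n) 0"
    by (rule extension_graph_null[OF G extension_graph_diff[OF G XY(1) Z]])
  then have Zy: "ru_convergent_to Z y"
    using ru_convergent_to_diff[OF XY(3)] by fastforce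
  have Zw: "\<bar>Z n\<bar> \<le> w" for n
    using extension_graphD(4)[OF G Z uw t_bound] .
  show "\<bar>y\<bar> \<le> w"
    using ru_limit_le[OF ru_convergent_to_abs[OF Zy] Zw] .
qed

lemma extension_graph_range: "extension_graph (range (\<lambda>a. (\<iota> a, T a)))"
  unfolding extension_graph_def
proof (intro conjI allI impI ballI)
  have "Real_Vector_Spaces.linear (\<lambda>a. (\<iota> a, T a))"
    by (intro linearI)
      (simp_all add: linear_add[OF linear] linear_add[OF linear_T]
        linear_scale[OF linear] linear_scale[OF linear_T])
  then show "subspace (range (\<lambda>a. (\<iota> a, T a)))"
    by (rule linear_subspace_image) simp
next
  fix x y assume "x \<in> Domain (range (\<lambda>a. (\<iota> a, T a)))" "y \<in> Domain (range (\<lambda>a. (\<iota> a, T a)))"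
  then obtain a b where "x = \<iota> a" "y = \<iota> b"
    by blast
  then show "sup x y \<in> Domain (range (\<lambda>a. (\<iota> a, T a)))"
    using rangeI[of "\<lambda>a. (\<iota> a, T a)" "sup a b"] unfolding sup by blast
next
  fix x y u w
  assume "(x, y) \<in> range (\<lambda>a. (\<iota> a, T a))" "maps_interval T u w" "\<bar>x\<bar> \<le> \<iota> u"
  then show "\<bar>y\<bar> \<le> w"
    unfolding maps_interval_def by (auto simp: le_iff simp flip: abs)
qed simp

lemma extension_graph_chain:
  assumes ne: "C \<noteq> {}" and C: "\<And>G. G \<in> C \<Longrightarrow> extension_graph G"
    and chain: "\<And>G H. G \<in> C \<Longrightarrow> H \<in> C \<Longrightarrow> G \<subseteq> H \<or> H \<subseteq> G"
  shows "extension_graph (\<Union>C)"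
  unfolding extension_graph_def
proof (intro conjI allI impI ballI)
  have common: "\<exists>G\<in>C. p \<in> G \<and> q \<in> G" if "p \<in> \<Union>C" "q \<in> \<Union>C" for p q
    using that chain by blast
  show "subspace (\<Union>C)"
  proof (rule subspaceI)
    show "0 \<in> \<Union>C"
      using ne subspace_0[OF extension_graphD(1)[OF C]] by blast
  next
    fix p q assume "p \<in> \<Union>C" "q \<in> \<Union>C"
    then show "p + q \<in> \<Union>C"
      using common subspace_add[OF extension_graphD(1)[OF C]] by (metis UnionI)
  next
    fix c p assume "p \<in> \<Union>C"
    then show "c *\<^sub>R p \<in> \<Union>C"
      using subspace_scale[OF extension_graphD(1)[OF C]] by blast
  qed
  show "range (\<lambda>a. (\<iota> a, T a)) \<subseteq> \<Union>C"
    using ne extension_graphD(2)[OF C] by blast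
  fix x y assume "x \<in> Domain (\<Union>C)" "y \<in> Domain (\<Union>C)"
  then obtain p q where "(x, p) \<in> \<Union>C" "(y, q) \<in> \<Union>C"
    by blast
  then obtain G where "G \<in> C" "(x, p) \<in> G" "(y, q) \<in> G"
    using common by metis
  then show "sup x y \<in> Domain (\<Union>C)"
    using extension_graphD(3)[OF C[OF \<open>G \<in> C\<close>]] by blast
next
  fix x y u w assume "(x, y) \<in> \<Union>C" "maps_interval T u w" "\<bar>x\<bar> \<le> \<iota> u"
  then show "\<bar>y\<bar> \<le> w"
    using extension_graphD(4)[OF C] by blast
qed

text \<open>A maximal extension graph equals the graph of its own limits. Completeness of \<open>B\<close> turns a
  convergent sequence in the domain into a convergent sequence in the graph, so the domain is closed
  and contains the completion.\<close>
lemma extension_exists: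
  "\<exists>S. S \<in> extensional (ru_completion \<iota>) \<and> linear_on (ru_completion \<iota>) S \<and>
    order_bounded_on (ru_completion \<iota>) S \<and> (\<forall>a. S (\<iota> a) = T a)"
proof -
  have "\<exists>G\<in>Collect extension_graph. \<forall>H\<in>Collect extension_graph. G \<subseteq> H \<longrightarrow> H = G"
  proof (rule subset_Zorn_nonempty)
    show "Collect extension_graph \<noteq> {}"
      using extension_graph_range by blast
    fix C assume "C \<noteq> {}" "subset.chain (Collect extension_graph) C"
    then show "\<Union>C \<in> Collect extension_graph"
      unfolding subset_chain_def using extension_graph_chain[of C] by blast
  qed
  then obtain G where G: "extension_graph G"
    and max: "\<And>H. extension_graph H \<Longrightarrow> G \<subseteq> H \<Longrightarrow> H = G"
    by blast
  have limit: "limit_graph G = G"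
    using extension_graph_limit_graph[OF G] limit_graph_superset by (rule max)
  have "ru_closed (Domain G)"
    unfolding ru_closed_def
  proof (intro allI impI)
    fix X x assume "range X \<subseteq> Domain G" and X: "ru_convergent_to X x"
    then have "\<forall>n. \<exists>y. (X n, y) \<in> G"
      by blast
    then obtain Y where XY: "\<And>n. (X n, Y n) \<in> G"
      by metis
    then obtain y where "ru_convergent_to Y y"
      using extension_graph_values_converge[OF G XY X] by blast
    then have "(x, y) \<in> limit_graph G"
      using XY X by (intro limit_graphI)
    then show "x \<in> Domain G"
      using limit by blast
  qed
  then have dom: "ru_completion \<iota> \<subseteq> Domain G"
    by (rule ru_completion_minimal) (use extension_graphD(2)[OF G] in blast)
  have single: "y = z" if "(x, y) \<in> G" "(x, z) \<in> G" for x y z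
  proof -
    have "(0, y - z) \<in> G"
      using extension_graph_diff[OF G that] by simp
    moreover have "maps_interval T 0 0"
      unfolding maps_interval_def by (simp add: linear_0[OF linear_T])
    ultimately have "\<bar>y - z\<bar> \<le> 0"
      using extension_graphD(4)[OF G] by (metis abs_zero linear linear_0 order_refl)
    then show ?thesis by simp
  qed
  define S where "S = restrict (\<lambda>x. SOME y. (x, y) \<in> G) (ru_completion \<iota>)"
  have S: "(x, S x) \<in> G" if "x \<in> ru_completion \<iota>" for x
    using dom that unfolding S_def by (auto intro: someI)
  note sub = extension_graphD(1)[OF G] and subR = subspace_completion
  have "linear_on (ru_completion \<iota>) S"
    unfolding linear_on_def
  proof (intro conjI ballI allI)
    fix x y assume xy: "x \<in> ru_completion \<iota>" "y \<in> ru_completion \<iota>"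
    have "(x + y, S x + S y) \<in> G"
      using subspace_add[OF sub S[OF xy(1)] S[OF xy(2)]] by simp
    then show "S (x + y) = S x + S y"
      using S[OF subspace_add[OF subR xy]] single by blast
  next
    fix c x assume x: "x \<in> ru_completion \<iota>"
    have "(c *\<^sub>R x, c *\<^sub>R S x) \<in> G"
      using subspace_scale[OF sub S[OF x]] by simp
    then show "S (c *\<^sub>R x) = c *\<^sub>R S x"
      using S[OF subspace_scale[OF subR x]] single by blast
  qed
  moreover have "order_bounded_on (ru_completion \<iota>) S"
    unfolding order_bounded_on_def
  proof (intro ballI)
    fix l h
    obtain u where u: "\<bar>l\<bar> + \<bar>h\<bar> \<le> \<iota> u"
      using majorizing by blast
    obtain w where w: "maps_interval T u w"
      using maps_some_interval by blast
    have "- w \<le> S x \<and> S x \<le> w" if x: "x \<in> ru_completion \<iota>" "l \<le> x" "x \<le> h" for x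
    proof -
      have "x \<le> \<bar>l\<bar> + \<bar>h\<bar>"
        using x(3) abs_ge_self[of h] abs_ge_zero[of l] by (meson add_increasing order_trans)
      moreover have "- x \<le> \<bar>l\<bar> + \<bar>h\<bar>"
        using x(2) abs_ge_minus_self[of l] abs_ge_zero[of h]
        by (meson add_increasing2 le_imp_neg_le order_trans)
      ultimately have "\<bar>x\<bar> \<le> \<iota> u"
        using u by (meson abs_leI order_trans)
      then have "\<bar>S x\<bar> \<le> w"
        using extension_graphD(4)[OF G S[OF x(1)] w] by blast
      then show ?thesis
        by (simp only: abs_le_interval_iff)
    qed
    then show "bdd_below (S ` (ru_completion \<iota> \<inter> {l..h})) \<and>
        bdd_above (S ` (ru_completion \<iota> \<inter> {l..h}))"
      by (auto intro!: bdd_belowI[of _ "- w"] bdd_aboveI[of _ w])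
  qed
  moreover have "S (\<iota> a) = T a" for a
    using single[OF S[OF in_completion] extension_graphD(2)[OF G]] .
  moreover have "S \<in> extensional (ru_completion \<iota>)"
    unfolding S_def by simp
  ultimately show ?thesis by blast
qed

section \<open>Uniqueness of the extension and transfer of the lattice structure\<close>

lemma completion_continuous:
  assumes "linear_on (ru_completion \<iota>) S" "order_bounded_on (ru_completion \<iota>) S"
    and "\<And>n. X n \<in> ru_completion \<iota>" "x \<in> ru_completion \<iota>" "ru_convergent_to X x"
  shows "ru_convergent_to (\<lambda>n. S (X n) :: 'b) (S x)"
  using subspace_completion completion_majorizing assms
  by (rule order_bounded_on_ru_continuous)

text \<open>Density of \<open>A\<close> in its completion: maps that are continuous on the completion and agree on \<open>A\<close>
  agree, because limits in \<open>B\<close> are unique.\<close>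
lemma completion_eqI:
  fixes f g :: "'d \<Rightarrow> 'b"
  assumes cont: "\<And>X x. (\<And>n. X n \<in> ru_completion \<iota>) \<Longrightarrow> x \<in> ru_completion \<iota> \<Longrightarrow>
      ru_convergent_to X x \<Longrightarrow> ru_convergent_to (\<lambda>n. f (X n)) (f x) \<and> ru_convergent_to (\<lambda>n. g (X n)) (g x)"
    and eq: "\<And>a. f (\<iota> a) = g (\<iota> a)"
    and x: "x \<in> ru_completion \<iota>"
  shows "f x = g x"
proof -
  have "ru_closed {x \<in> ru_completion \<iota>. f x = g x}"
    unfolding ru_closed_def
  proof (intro allI impI)
    fix X x assume "range X \<subseteq> {x \<in> ru_completion \<iota>. f x = g x}" and X: "ru_convergent_to X x"
    then have R: "\<And>n. X n \<in> ru_completion \<iota>" and fg: "\<And>n. f (X n) = g (X n)"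
      by auto
    then have x: "x \<in> ru_completion \<iota>"
      using ru_closed_ru_completion[of \<iota>] X unfolding ru_closed_def by blast
    have "f x = g x"
      using cont[OF R x X] fg by (auto intro: ru_limit_unique)
    with x show "x \<in> {x \<in> ru_completion \<iota>. f x = g x}"
      by blast
  qed
  then have "ru_completion \<iota> \<subseteq> {x \<in> ru_completion \<iota>. f x = g x}"
    by (rule ru_completion_minimal) (use eq in_completion in auto)
  then show ?thesis
    using x by blast
qed

lemma ru_extension:
  defines "S \<equiv> ru_extension \<iota> T"
  shows "linear_on (ru_completion \<iota>) S" "order_bounded_on (ru_completion \<iota>) S" "S (\<iota> a) = T a"
proof -
  let ?P = "\<lambda>S. S \<in> extensional (ru_completion \<iota>) \<and> linear_on (ru_completion \<iota>) S \<and>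
    order_bounded_on (ru_completion \<iota>) S \<and> (\<forall>a. S (\<iota> a) = T a)"
  have "S = S'" if S: "?P S" and S': "?P S'" for S S'
  proof (rule extensionalityI)
    fix x assume "x \<in> ru_completion \<iota>"
    then show "S x = S' x"
      by (rule completion_eqI[rotated 2]) (use S S' completion_continuous in auto)
  qed (use S S' in auto)
  then have "\<exists>!S. ?P S"
    using extension_exists by blast
  then have "?P S"
    unfolding S_def ru_extension_def by (rule theI')
  then show "linear_on (ru_completion \<iota>) S" "order_bounded_on (ru_completion \<iota>) S" "S (\<iota> a) = T a"
    by blast+
qed

text \<open>The absolute value has one argument, so a single density argument gives
  \<open>S \<bar>x\<bar> = \<bar>S x\<bar>\<close>. Suprema and infima are linear combinations of \<open>x\<close>, \<open>y\<close> and \<open>\<bar>x - y\<bar>\<close>.\<close>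
lemma lattice_hom_on_ru_extension:
  assumes T: "lattice_hom_on UNIV T"
  shows "lattice_hom_on (ru_completion \<iota>) (ru_extension \<iota> T)"
proof -
  define S where "S = ru_extension \<iota> T"
  note S = ru_extension[folded S_def]
  note cont = completion_continuous[OF S(1,2)]
  have T_abs: "T \<bar>a\<bar> = \<bar>T a\<bar>" for a
    using T unfolding lattice_hom_on_def by (simp add: abs_lattice linear_neg[OF linear_T])
  have S_abs: "S \<bar>x\<bar> = \<bar>S x\<bar>" if "x \<in> ru_completion \<iota>" for x
  proof (rule completion_eqI[OF _ _ that])
    show "S \<bar>\<iota> a\<bar> = \<bar>S (\<iota> a)\<bar>" for a
      using S(3)[of "\<bar>a\<bar>"] S(3)[of a] by (simp add: abs T_abs)
  qed (intro conjI cont abs_in_completion ru_convergent_to_abs; assumption)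
  note S_diff = linear_on_diff[OF S(1) subspace_completion]
  have S_sup: "S (sup x y) = sup (S x) (S y) \<and> sup x y \<in> ru_completion \<iota>"
    if xy: "x \<in> ru_completion \<iota>" "y \<in> ru_completion \<iota>" for x y
  proof -
    note sub = subspace_completion
    have "\<bar>x - y\<bar> \<in> ru_completion \<iota>"
      using abs_in_completion[OF subspace_diff[OF sub xy]] .
    then show ?thesis
      using S(1) S_abs[OF subspace_diff[OF sub xy]] S_diff[OF xy] xy
        subspace_add[OF sub] subspace_scale[OF sub]
      unfolding linear_on_def sup_eq_half_abs by simp
  qed
  have "S (inf x y) = inf (S x) (S y)" if xy: "x \<in> ru_completion \<iota>" "y \<in> ru_completion \<iota>" for x y
  proof -
    have "S (inf x y) = S (x + y) - S (sup x y)"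
      unfolding inf_eq_add_diff_sup
      using S_diff[OF subspace_add[OF subspace_completion xy]] S_sup[OF xy] by blast
    also have "\<dots> = S x + S y - sup (S x) (S y)"
      using S_sup[OF xy] S(1) xy unfolding linear_on_def by simp
    finally show ?thesis
      unfolding inf_eq_add_diff_sup .
  qed
  then show ?thesis
    using S_sup unfolding lattice_hom_on_def S_def by blast
qed

end

theorem proposition5:
  fixes \<iota> :: "'a::{f_algebra, archimedean_riesz_space} \<Rightarrow> 'd::dedekind_complete_riesz_space"
    and T :: "'a \<Rightarrow> 'b::{semiprime_f_algebra, archimedean_riesz_space, ru_complete_riesz_space}"
  assumes "dedekind_completion \<iota>"
    and "linear T"
    and "order_bounded_on UNIV T"
  shows "lattice_hom_on UNIV T \<longleftrightarrow> lattice_hom_on (ru_completion \<iota>) (ru_extension \<iota> T)"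
proof -
  interpret order_bounded_operator \<iota> T
    using dedekind_completion_majorizing[OF assms(1)] assms(2,3)
    by (intro order_bounded_operator.intro order_bounded_operator_axioms.intro)
  show ?thesis
  proof
    assume "lattice_hom_on UNIV T"
    then show "lattice_hom_on (ru_completion \<iota>) (ru_extension \<iota> T)"
      by (rule lattice_hom_on_ru_extension)
  next
    assume "lattice_hom_on (ru_completion \<iota>) (ru_extension \<iota> T)"
    then show "lattice_hom_on UNIV T"
      using in_completion unfolding lattice_hom_on_def
      by (auto simp: sup inf simp flip: ru_extension(3))
  qed
qed

end
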